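(* $\mathbf{SC}(1,1)=\mathbf{SC}'(1,1)$.
   Context: For an alphabet $V$, $V^+=V^*-\{\lambda\}$, and $\mathit{alph}(w)$ is the set of symbols occurring in $w$. A semi-conditional grammar of degree $(1,1)$ is a quadruple $G=(N,T,P,S)$ where $N$ and $T$ are disjoint finite alphabets of nonterminals and terminals, $V=N\cup T$, $S\in N$, and $P$ is a finite set of productions $(A\to x,\mathit{Per},\mathit{For})$ with $A\in N$, $x\in V^+$ (no erasing productions), $\mathit{Per},\mathit{For}\subseteq V$, $|\mathit{Per}|\le1$, $|\mathit{For}|\le1$. Its language is $L(G)=\{w\in T^*:S\Rightarrow^*w\}$. $\mathbf{SC}(1,1)$ is the family of languages generated by such grammars when the derivation step $uAv\Rightarrow uxv$ ($u,v\in V^*$) by $(A\to x,\mathit{Per},\mathit{For})$ requires $\mathit{Per}\subseteq\mathit{alph}(uAv)$ and $\mathit{alph}(uAv)\cap\mathit{For}=\emptyset$. $\mathbf{SC}'(1,1)$ is the family of languages generated by such grammars when the derivation step instead requires $\mathit{Per}\subseteq\mathit{alph}(uv)$ and $\mathit{alph}(uv)\cap\mathit{For}=\emptyset$. *)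

theory Defs
  imports Main
begin

text \<open>Symbols: nonterminals are drawn from nat (any finite alphabet can be renamed into nat),
  terminals from an arbitrary type 't; hence N and T are automatically disjoint.\<close>
datatype 't sym = NT nat | Tm 't

type_synonym 't prod = "nat \<times> 't sym list \<times> 't sym set \<times> 't sym set"

record 't scgrammar =
  nts :: "nat set"
  tms :: "'t set"
  prods :: "'t prod set"
  start :: nat

definition voc :: "'t scgrammar \<Rightarrow> 't sym set" where
  "voc G = NT ` nts G \<union> Tm ` tms G"

definition sc11_grammar :: "'t scgrammar \<Rightarrow> bool" where
  "sc11_grammar G \<longleftrightarrow>
     finite (nts G) \<and> finite (tms G) \<and> finite (prods G) \<and> start G \<in> nts G \<and>
     (\<forall>(A, x, Per, For) \<in> prods G.
        A \<in> nts G \<and> x \<noteq> [] \<and> set x \<subseteq> voc G \<and>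
        Per \<subseteq> voc G \<and> For \<subseteq> voc G \<and>
        finite Per \<and> finite For \<and> card Per \<le> 1 \<and> card For \<le> 1)"

definition sc_step :: "'t scgrammar \<Rightarrow> 't sym list \<Rightarrow> 't sym list \<Rightarrow> bool" where
  "sc_step G w w' \<longleftrightarrow>
     (\<exists>A x Per For u v. (A, x, Per, For) \<in> prods G \<and>
        w = u @ [NT A] @ v \<and> w' = u @ x @ v \<and>
        Per \<subseteq> set (u @ [NT A] @ v) \<and> set (u @ [NT A] @ v) \<inter> For = {})"

definition sc'_step :: "'t scgrammar \<Rightarrow> 't sym list \<Rightarrow> 't sym list \<Rightarrow> bool" where
  "sc'_step G w w' \<longleftrightarrow>
     (\<exists>A x Per For u v. (A, x, Per, For) \<in> prods G \<and>
        w = u @ [NT A] @ v \<and> w' = u @ x @ v \<and>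
        Per \<subseteq> set (u @ v) \<and> set (u @ v) \<inter> For = {})"

definition lang_sc :: "'t scgrammar \<Rightarrow> 't list set" where
  "lang_sc G = {w. set w \<subseteq> tms G \<and> (sc_step G)\<^sup>*\<^sup>* [NT (start G)] (map Tm w)}"

definition lang_sc' :: "'t scgrammar \<Rightarrow> 't list set" where
  "lang_sc' G = {w. set w \<subseteq> tms G \<and> (sc'_step G)\<^sup>*\<^sup>* [NT (start G)] (map Tm w)}"

definition SC11 :: "'t list set set" where
  "SC11 = {L. \<exists>G. sc11_grammar G \<and> L = lang_sc G}"

definition SC'11 :: "'t list set set" where
  "SC'11 = {L. \<exists>G. sc11_grammar G \<and> L = lang_sc' G}"

end

theory Submission
  imports Defs
begin

text \<open>Both semantics agree on a rule for \<open>A\<close> unless \<open>A\<close> itself occurs in its context conditions.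
  Under the \<open>SC\<close> semantics such an occurrence is trivial: \<open>A\<close> as forbidden symbol disables the rule,
  and \<open>A\<close> as permitting symbol imposes nothing. Hence \<open>SC(1,1) \<subseteq> SC'(1,1)\<close>.

  Conversely, the leftmost symbol \<open>X\<close> of the sentential form is replaced by a nonterminal that
  carries \<open>X\<close> together with a control state. A rule \<open>r = (A \<rightarrow> x, Per, For)\<close> is applied to a
  non-leftmost \<open>A\<close> by entering the state \<open>Guess X r\<close>, replacing one \<open>A\<close> by the marker \<open>Mark\<close>,
  checking \<open>Per\<close> and \<open>For\<close> while passing to \<open>Fire X r\<close> (the selected \<open>A\<close> is now hidden, so
  only its context is inspected), and replacing \<open>Mark\<close> by \<open>x\<close>. Every rule not rewriting the
  leftmost symbol spends its permitting condition on the state; the rules rewriting the leftmost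
  symbol need no such condition and are free to test \<open>Per\<close> and \<open>For\<close>.\<close>

section \<open>Conditions on the rewritten symbol itself: \<open>SC(1,1)\<close> inside
  \<open>SC'(1,1)\<close>\<close>

definition strip_self :: "'t scgrammar \<Rightarrow> 't scgrammar" where
  "strip_self G = G\<lparr>prods := {(A, x, P, For). \<exists>Per.
     (A, x, Per, For) \<in> prods G \<and> NT A \<notin> For \<and> P = Per - {NT A}}\<rparr>"

lemma strip_self_simps [simp]:
  "nts (strip_self G) = nts G" "tms (strip_self G) = tms G" "start (strip_self G) = start G"
  "voc (strip_self G) = voc G"
  by (simp_all add: strip_self_def voc_def)

lemma prods_strip_self:
  "(A, x, P, For) \<in> prods (strip_self G) \<longleftrightarrow>
     (\<exists>Per. (A, x, Per, For) \<in> prods G \<and> NT A \<notin> For \<and> P = Per - {NT A})"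
  by (simp add: strip_self_def)

lemma sc'_step_strip_self: "sc'_step (strip_self G) = sc_step G"
proof -
  have "P - {NT A} \<subseteq> set (u @ v) \<longleftrightarrow> P \<subseteq> set (u @ [NT A] @ v)" for P A and u v :: "'a sym list"
    by auto
  moreover have "NT A \<notin> F \<and> set (u @ v) \<inter> F = {} \<longleftrightarrow> set (u @ [NT A] @ v) \<inter> F = {}"
    for F A and u v :: "'a sym list"
    by auto
  ultimately show ?thesis
    unfolding sc_step_def sc'_step_def prods_strip_self by (intro ext) metis
qed

lemma sc11_grammar_strip_self:
  assumes "sc11_grammar G"
  shows "sc11_grammar (strip_self G)"
proof -
  have card_le: "card (Per - {B}) \<le> 1" if "card Per \<le> 1" "finite Per" for Per :: "'a sym set" and B
    using that card_mono[of Per "Per - {B}"] by auto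
  have "finite (prods G)" using assms by (simp add: sc11_grammar_def)
  moreover have "prods (strip_self G) \<subseteq> (\<lambda>(A, x, Per, For). (A, x, Per - {NT A}, For)) ` prods G"
    by (force simp: strip_self_def)
  ultimately have "finite (prods (strip_self G))"
    using finite_surj by blast
  then show ?thesis
    using assms card_le unfolding sc11_grammar_def by (fastforce simp: prods_strip_self)
qed

lemma SC11_subset_SC'11: "(SC11 :: 't list set set) \<subseteq> SC'11"
proof -
  have "lang_sc' (strip_self G) = lang_sc G" for G :: "'t scgrammar"
    by (simp add: lang_sc_def lang_sc'_def sc'_step_strip_self)
  then show ?thesis
    unfolding SC11_def SC'11_def using sc11_grammar_strip_self by blast
qed

section \<open>The simulating grammar for the converse inclusion\<close>

datatype 't control =
  Mark
| Idle "'t sym"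
| Guess "'t sym" "'t prod"
| Fire "'t sym" "'t prod"

definition controls :: "'t scgrammar \<Rightarrow> 't control set" where
  "controls G = {Mark} \<union> Idle ` voc G \<union> (\<lambda>(X, r). Guess X r) ` (voc G \<times> prods G)
      \<union> (\<lambda>(X, r). Fire X r) ` (voc G \<times> prods G)"

text \<open>The type of controls is infinite, so injectivity is asked only on the finite set
  \<open>controls G\<close>. Freshness is asked of every control, which makes
  \<open>ctl_notin_voc\<close> unconditional.\<close>

locale simulation =
  fixes G :: "'t scgrammar" and code :: "'t control \<Rightarrow> nat"
  assumes G: "sc11_grammar G"
    and inj: "inj_on code (controls G)"
    and fresh: "code c \<notin> nts G"
begin

definition ctl :: "'t control \<Rightarrow> 't sym" where
  "ctl c = NT (code c)"

text \<open>The forbidden marker in \<open>mark\<close> keeps markers unique, and in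
  \<open>return\<close> it keeps the state until the marker is replaced. In \<open>check\<close> the
  symbol \<open>X\<close> belongs to the context but is stored in the control; hence it is dropped
  from \<open>Per\<close> and must lie outside \<open>For\<close>.\<close>

inductive_set rules :: "'t prod set" where
  finish: "a \<in> tms G \<Longrightarrow> (code (Idle (Tm a)), [Tm a], {}, {}) \<in> rules"
| direct: "(A, x, Per, For) \<in> prods G \<Longrightarrow>
    (code (Idle (NT A)), ctl (Idle (hd x)) # tl x, Per, For) \<in> rules"
| choose: "r \<in> prods G \<Longrightarrow> X \<in> voc G \<Longrightarrow> (code (Idle X), [ctl (Guess X r)], {}, {}) \<in> rules"
| mark: "(A, x, Per, For) \<in> prods G \<Longrightarrow> X \<in> voc G \<Longrightarrow>
    (A, [ctl Mark], {ctl (Guess X (A, x, Per, For))}, {ctl Mark}) \<in> rules"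
| check: "(A, x, Per, For) \<in> prods G \<Longrightarrow> X \<in> voc G \<Longrightarrow> X \<notin> For \<Longrightarrow>
    (code (Guess X (A, x, Per, For)), [ctl (Fire X (A, x, Per, For))], Per - {X}, For) \<in> rules"
| fire: "(A, x, Per, For) \<in> prods G \<Longrightarrow> X \<in> voc G \<Longrightarrow>
    (code Mark, x, {ctl (Fire X (A, x, Per, For))}, {}) \<in> rules"
| return: "r \<in> prods G \<Longrightarrow> X \<in> voc G \<Longrightarrow>
    (code (Fire X r), [ctl (Idle X)], {}, {ctl Mark}) \<in> rules"

definition G' :: "'t scgrammar" where
  "G' = \<lparr>nts = nts G \<union> code ` controls G, tms = tms G, prods = rules,
     start = code (Idle (NT (start G)))\<rparr>"

lemma G'_simps [simp]:
  "nts G' = nts G \<union> code ` controls G" "tms G' = tms G" "prods G' = rules"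
  "start G' = code (Idle (NT (start G)))"
  by (simp_all add: G'_def)

lemma prodD:
  assumes "(A, x, Per, For) \<in> prods G"
  shows "A \<in> nts G" "NT A \<in> voc G" "x \<noteq> []" "set x \<subseteq> voc G" "Per \<subseteq> voc G" "For \<subseteq> voc G"
    "finite Per" "finite For" "card Per \<le> 1" "card For \<le> 1"
  using G assms unfolding sc11_grammar_def by (auto simp: voc_def)

lemma ctl_notin_voc [simp]: "ctl c \<notin> voc G"
  using fresh by (auto simp: ctl_def voc_def)

lemma ctl_neq_Tm [simp]: "ctl c \<noteq> Tm a" "Tm a \<noteq> ctl c"
  by (auto simp: ctl_def)

lemma code_eq_iff [simp]: "c \<in> controls G \<Longrightarrow> d \<in> controls G \<Longrightarrow> code c = code d \<longleftrightarrow> c = d"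
  using inj by (auto dest: inj_onD)

lemma ctl_eq_iff [simp]: "c \<in> controls G \<Longrightarrow> d \<in> controls G \<Longrightarrow> ctl c = ctl d \<longleftrightarrow> c = d"
  by (simp add: ctl_def)

lemma in_controls [simp]:
  "Mark \<in> controls G"
  "Idle X \<in> controls G \<longleftrightarrow> X \<in> voc G"
  "Guess X r \<in> controls G \<longleftrightarrow> X \<in> voc G \<and> r \<in> prods G"
  "Fire X r \<in> controls G \<longleftrightarrow> X \<in> voc G \<and> r \<in> prods G"
  by (auto simp: controls_def)

lemma finite_voc: "finite (voc G)"
  using G by (simp add: sc11_grammar_def voc_def)

lemma voc_G': "voc G' = voc G \<union> ctl ` controls G"
  by (auto simp: voc_def ctl_def)

lemma rules_wellformed:
  assumes "(B, y, P, F) \<in> rules"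
  shows "B \<in> nts G' \<and> y \<noteq> [] \<and> set y \<subseteq> voc G' \<and> P \<subseteq> voc G' \<and> F \<subseteq> voc G' \<and>
    finite P \<and> finite F \<and> card P \<le> 1 \<and> card F \<le> 1"
proof -
  have ctl: "ctl c \<in> voc G'" "code c \<in> nts G'" if "c \<in> controls G" for c
    using that by (simp_all add: voc_G')
  have voc: "X \<in> voc G'" if "X \<in> voc G" for X
    using that by (simp add: voc_G')
  have hd_tl: "hd x \<in> voc G" "set (tl x) \<subseteq> voc G" if "(A, x, Per, For) \<in> prods G" for A x Per For
    using prodD(3,4)[OF that] by (cases x; auto)+
  from assms show ?thesis
  proof cases
    case (finish a)
    then have "Tm a \<in> voc G" by (simp add: voc_def)
    with finish show ?thesis by (simp add: ctl voc del: G'_simps)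
  next
    case (direct A x)
    note p = prodD[OF direct(3)]
    have "set y \<subseteq> voc G'" using direct hd_tl[OF direct(3)] ctl voc by auto
    with direct p show ?thesis by (auto simp: ctl voc simp del: G'_simps)
  next
    case (choose r X)
    then show ?thesis by (simp add: ctl del: G'_simps)
  next
    case (mark x Per For X)
    note p = prodD[OF mark(4)]
    with mark show ?thesis by (simp add: ctl del: G'_simps) simp
  next
    case (check A x Per X)
    note p = prodD[OF check(4)]
    have "card P \<le> 1" using p card_mono[of Per P] check by auto
    moreover have "P \<subseteq> voc G'" "F \<subseteq> voc G'" using p check voc by auto
    ultimately show ?thesis using p check by (simp add: ctl del: G'_simps)
  next
    case (fire A Per For X)
    note p = prodD[OF fire(4)]
    then have "set y \<subseteq> voc G'" using voc by auto
    with fire p show ?thesis by (simp add: ctl del: G'_simps)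
  next
    case (return r X)
    then show ?thesis by (simp add: ctl del: G'_simps)
  qed
qed

lemma sc11_grammar_G': "sc11_grammar G'"
proof -
  have fin: "finite (prods G)" "finite (tms G)" "finite (nts G)" "start G \<in> nts G"
    using G by (auto simp: sc11_grammar_def)
  then have fin': "finite (nts G')" "finite (voc G')"
    using finite_voc by (auto simp: controls_def voc_G')
  \<comment> \<open>Finiteness of \<open>rules\<close> comes from an embedding into a finite
    product. \<open>R\<close> covers the right-hand sides: single symbols, those of
    \<open>G\<close>, and those of \<open>G\<close> with the first symbol turned into a
    control.\<close>
  define R where "R = (\<lambda>X. [X]) ` voc G' \<union> (fst \<circ> snd) ` prods G \<union>
    (\<lambda>r. ctl (Idle (hd (fst (snd r)))) # tl (fst (snd r))) ` prods G"
  have "y \<in> R" if r: "(B, y, P, F) \<in> rules" for B y P F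
    using r
  proof cases
    case (direct A x)
    then show ?thesis unfolding R_def by force
  next
    case (fire A Per For X)
    then show ?thesis unfolding R_def by force
  qed (use rules_wellformed[OF r] in \<open>auto simp: R_def\<close>)
  then have "rules \<subseteq> nts G' \<times> R \<times> Pow (voc G') \<times> Pow (voc G')"
    using rules_wellformed by (simp add: subset_iff split_paired_all del: G'_simps)
  moreover have "finite R" using fin fin' by (simp add: R_def)
  ultimately have "finite rules"
    using fin' by (meson finite_Pow_iff finite_SigmaI finite_subset)
  moreover have "\<forall>(A, x, Per, For) \<in> prods G'. A \<in> nts G' \<and> x \<noteq> [] \<and> set x \<subseteq> voc G' \<and>
      Per \<subseteq> voc G' \<and> For \<subseteq> voc G' \<and> finite Per \<and> finite For \<and> card Per \<le> 1 \<and> card For \<le> 1"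
    unfolding G'_simps(3) using rules_wellformed by blast
  moreover have "NT (start G) \<in> voc G" using fin by (simp add: voc_def)
  then have "start G' \<in> nts G'" by simp
  ultimately show ?thesis
    using fin fin' unfolding sc11_grammar_def by simp
qed

text \<open>The head is the only control besides markers. So a rule for another control rewrites the
  head, and a permitting \<open>Guess\<close> or \<open>Fire\<close> symbol must be the head. As the
  head lies outside \<open>voc G\<close>, conditions over \<open>voc G\<close> concern
  \<open>v\<close> alone.\<close>

lemma sc_step_G'_cases [consumes 4, case_names finish direct choose mark fire return check]:
  assumes "sc_step G' (ctl c # v) w'"
    and c: "c \<in> controls G" "c \<noteq> Mark" and v: "set v \<subseteq> insert (ctl Mark) (voc G)"
  obtains
    a where "a \<in> tms G" "c = Idle (Tm a)" "w' = Tm a # v"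
  | A x Per For where "(A, x, Per, For) \<in> prods G" "c = Idle (NT A)"
      "w' = ctl (Idle (hd x)) # tl x @ v" "Per \<subseteq> set v" "set v \<inter> For = {}"
  | X r where "r \<in> prods G" "c = Idle X" "w' = ctl (Guess X r) # v"
  | X A x Per For v1 v2 where "(A, x, Per, For) \<in> prods G" "c = Guess X (A, x, Per, For)"
      "v = v1 @ NT A # v2" "ctl Mark \<notin> set v" "w' = ctl c # v1 @ ctl Mark # v2"
  | X A x Per For v1 v2 where "(A, x, Per, For) \<in> prods G" "c = Fire X (A, x, Per, For)"
      "v = v1 @ ctl Mark # v2" "w' = ctl c # v1 @ x @ v2"
  | X r where "r \<in> prods G" "c = Fire X r" "ctl Mark \<notin> set v" "w' = ctl (Idle X) # v"
  | X A x Per For where "(A, x, Per, For) \<in> prods G" "c = Guess X (A, x, Per, For)"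
      "X \<notin> For" "Per - {X} \<subseteq> set v" "set v \<inter> For = {}" "w' = ctl (Fire X (A, x, Per, For)) # v"
proof -
  from assms(1) obtain B y P F u z where p: "(B, y, P, F) \<in> prods G'"
    and w: "ctl c # v = u @ [NT B] @ z" "w' = u @ y @ z"
    and P: "P \<subseteq> set (ctl c # v)" and F: "set (ctl c # v) \<inter> F = {}"
    unfolding sc_step_def by auto
  have in_v: "ctl d \<in> set v \<Longrightarrow> d \<in> controls G \<Longrightarrow> d = Mark" for d
    using v by auto
  have hd: "u = [] \<and> z = v \<and> d = c" if "B = code d" "d \<in> controls G" "d \<noteq> Mark" for d
  proof (cases u)
    case Nil
    then show ?thesis using w that c by (simp add: ctl_def)
  next
    case (Cons a u')
    then have "ctl d \<in> set v" using w that by (simp add: ctl_def)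
    then show ?thesis using in_v that by blast
  qed
  have tl: "\<exists>u'. u = ctl c # u' \<and> v = u' @ NT B # z" if "NT B \<noteq> ctl c"
    using w that by (cases u) auto
  from p have "(B, y, P, F) \<in> rules" by simp
  then show thesis
  proof cases
    case (finish a)
    then show thesis using hd[of "Idle (Tm a)"] w that(1)[of a] by (auto simp: voc_def)
  next
    case (direct A x)
    note p = prodD[OF direct(3)]
    then have "ctl c \<notin> P" by auto
    then show thesis using hd[of "Idle (NT A)"] direct p w P F that(2)[of A x P F] by auto
  next
    case (choose r X)
    then show thesis using hd[of "Idle X"] w that(3)[of r X] by auto
  next
    case (mark x Per For X)
    note p = prodD[OF mark(4)]
    then have "NT B \<noteq> ctl c" by (metis ctl_notin_voc)
    then obtain u' where "u = ctl c # u'" "v = u' @ NT B # z" using tl by blast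
    moreover have "c = Guess X (B, x, Per, For)"
      using mark P c in_v[of "Guess X (B, x, Per, For)"] by auto
    ultimately show thesis using mark w F that(4)[of B x Per For X u' z] by auto
  next
    case (check A x Per X)
    note p = prodD[OF check(4)]
    then have "ctl c \<notin> Per" by auto
    then show thesis
      using hd[of "Guess X (A, x, Per, F)"] check w P F that(7)[of A x Per F X] by auto
  next
    case (fire A Per For X)
    then have "NT B \<noteq> ctl c" using c by (simp add: ctl_def)
    then obtain u' where "u = ctl c # u'" "v = u' @ NT B # z" using tl by blast
    moreover have "c = Fire X (A, y, Per, For)"
      using fire P c in_v[of "Fire X (A, y, Per, For)"] by auto
    ultimately show thesis using fire w that(5)[of A y Per For X u' z] by (auto simp: ctl_def)
  next
    case (return r X)
    then show thesis using hd[of "Fire X r"] w F that(6)[of r X] by auto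
  qed
qed

text \<open>Each rule rewrites a control or, in the case of \<open>mark\<close>, requires one to be
  present. Thus a derivation is stuck once \<open>finish\<close> has released the last
  control.\<close>

lemma no_sc_step_G':
  assumes "set w \<subseteq> voc G"
  shows "\<not> sc_step G' w w'"
proof
  have no: "ctl c \<notin> set w" "NT (code c) \<notin> set w" for c
    using assms ctl_notin_voc[of c] by (auto simp: ctl_def)
  assume "sc_step G' w w'"
  then obtain B y P F where p: "(B, y, P, F) \<in> rules" and B: "NT B \<in> set w" and P: "P \<subseteq> set w"
    unfolding sc_step_def by auto
  from p show False
    by cases (use B P no in auto)
qed

section \<open>Soundness: an invariant of derivations in \<open>G'\<close>\<close>

definition derivable :: "'t sym list \<Rightarrow> bool" where
  "derivable w \<longleftrightarrow> set w \<subseteq> voc G \<and> (sc'_step G)\<^sup>*\<^sup>* [NT (start G)] w"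

lemma derivable_start: "derivable [NT (start G)]"
  using G by (simp add: derivable_def sc11_grammar_def voc_def)

lemma derivable_step:
  assumes "derivable (u @ NT A # v)" "(A, x, Per, For) \<in> prods G"
    "Per \<subseteq> set (u @ v)" "set (u @ v) \<inter> For = {}"
  shows "derivable (u @ x @ v)"
proof -
  have "sc'_step G (u @ NT A # v) (u @ x @ v)"
    unfolding sc'_step_def using assms by fastforce
  then show ?thesis
    using assms prodD[OF assms(2)] unfolding derivable_def by (auto intro: rtranclp.rtrancl_into_rtrancl)
qed

text \<open>A marked form in a \<open>Fire\<close> state stands for the result of the pending rule application, since
  the context conditions have already been verified.\<close>
inductive simulates :: "'t sym list \<Rightarrow> bool" where
  idle: "derivable (X # v) \<Longrightarrow> simulates (ctl (Idle X) # v)"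
| guess: "derivable (X # v) \<Longrightarrow> r \<in> prods G \<Longrightarrow> simulates (ctl (Guess X r) # v)"
| marked: "derivable (X # v1 @ NT A # v2) \<Longrightarrow> (A, x, Per, For) \<in> prods G \<Longrightarrow>
    simulates (ctl (Guess X (A, x, Per, For)) # v1 @ ctl Mark # v2)"
| fire: "derivable (X # v1 @ x @ v2) \<Longrightarrow> (A, x, Per, For) \<in> prods G \<Longrightarrow>
    simulates (ctl (Fire X (A, x, Per, For)) # v1 @ ctl Mark # v2)"
| fired: "derivable (X # v) \<Longrightarrow> r \<in> prods G \<Longrightarrow> simulates (ctl (Fire X r) # v)"
| finished: "derivable w \<Longrightarrow> simulates w"

text \<open>Guarantees that \<open>fire\<close> acts at the position that was marked and checked,
  because the marker occurs only once.\<close>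

lemma voc_split_Mark:
  assumes "v1 @ ctl Mark # v2 = u1 @ ctl Mark # u2" "set v1 \<union> set v2 \<subseteq> voc G"
  shows "u1 = v1 \<and> u2 = v2"
proof -
  have "ctl Mark \<notin> set v1" "ctl Mark \<notin> set v2" using assms(2) ctl_notin_voc by blast+
  with assms(1) show ?thesis by (metis append_Cons_eq_iff)
qed

text \<open>The represented form of \<open>G\<close> changes only under \<open>direct\<close> and
  under \<open>check\<close> with a marker present; every other step preserves it.\<close>

lemma simulates_step:
  assumes "simulates w" "sc_step G' w w'"
  shows "simulates w'"
  using assms
proof cases
  case (idle X v)
  then have "Idle X \<in> controls G" "Idle X \<noteq> Mark" "set v \<subseteq> insert (ctl Mark) (voc G)"
    by (auto simp: derivable_def)
  with assms(2)[unfolded idle] show ?thesis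
  proof (cases rule: sc_step_G'_cases)
    case (direct A x Per For)
    then have "derivable (x @ v)"
      using derivable_step[of "[]" A v x Per For] idle by auto
    then show ?thesis
      using direct prodD(3)[OF direct(1)] simulates.idle[of "hd x" "tl x @ v"] by (cases x) auto
  qed (use idle in \<open>auto intro: simulates.intros\<close>)
next
  case (guess X v r)
  then have "Guess X r \<in> controls G" "Guess X r \<noteq> Mark" "set v \<subseteq> insert (ctl Mark) (voc G)"
    by (auto simp: derivable_def)
  with assms(2)[unfolded guess] show ?thesis
    \<comment> \<open>Here \<open>check\<close> may also be applied with no marker present. This is
      harmless: it leads to \<open>fired\<close> with the same represented form, and only
      \<open>return\<close> can follow.\<close>
    by (cases rule: sc_step_G'_cases) (use guess in \<open>auto intro: simulates.intros\<close>)
next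
  case (marked X v1 A v2 x Per For)
  note p = prodD[OF marked(3)]
  have V: "X \<in> voc G" "set v1 \<subseteq> voc G" "set v2 \<subseteq> voc G"
    using marked by (auto simp: derivable_def)
  then have "Guess X (A, x, Per, For) \<in> controls G" "Guess X (A, x, Per, For) \<noteq> Mark"
    "set (v1 @ ctl Mark # v2) \<subseteq> insert (ctl Mark) (voc G)"
    using marked by auto
  with assms(2)[unfolded marked] show ?thesis
  proof (cases rule: sc_step_G'_cases)
    case (check X' A' x' Per' For')
    then have [simp]: "X' = X" "A' = A" "x' = x" "Per' = Per" "For' = For" by auto
    \<comment> \<open>The tested form has the marker in place of the hidden \<open>A\<close>. Since
      the marker cannot serve as permitting symbol, \<open>Per\<close> is found in the true
      context.\<close>
    have "ctl Mark \<notin> Per" using p by auto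
    then have "derivable ((X # v1) @ x @ v2)"
      using check marked by (intro derivable_step[of "X # v1" A v2 x Per For]) auto
    then show ?thesis using check by (auto intro: simulates.fire)
  next
    \<comment> \<open>A second marking is blocked by the marker already present.\<close>
    case (mark X' A' x' Per' For' u1 u2)
    then show ?thesis by (metis in_set_conv_decomp)
  qed (use marked in \<open>auto intro: simulates.intros\<close>)
next
  case (fire X v1 x v2 A Per For)
  have V: "X \<in> voc G" "set v1 \<subseteq> voc G" "set v2 \<subseteq> voc G"
    using fire by (auto simp: derivable_def)
  then have "Fire X (A, x, Per, For) \<in> controls G" "Fire X (A, x, Per, For) \<noteq> Mark"
    "set (v1 @ ctl Mark # v2) \<subseteq> insert (ctl Mark) (voc G)"
    using fire by auto
  with assms(2)[unfolded fire] show ?thesis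
  proof (cases rule: sc_step_G'_cases)
    case (fire X' A' x' Per' For' u1 u2)
    then have "u1 = v1 \<and> u2 = v2" using voc_split_Mark V by blast
    then show ?thesis
      using fire \<open>derivable (X # v1 @ x @ v2)\<close> by (auto intro: simulates.fired)
  qed (use fire in \<open>auto intro: simulates.intros\<close>)
next
  case (fired X v r)
  then have H: "Fire X r \<in> controls G" "Fire X r \<noteq> Mark" "set v \<subseteq> insert (ctl Mark) (voc G)"
    by (auto simp: derivable_def)
  have "ctl Mark \<notin> set v"
    using fired ctl_notin_voc[of Mark] by (auto simp: derivable_def)
  from assms(2)[unfolded fired] H show ?thesis
  proof (cases rule: sc_step_G'_cases)
    case (fire X' A x Per For v1 v2)
    then show ?thesis using \<open>ctl Mark \<notin> set v\<close> by simp
  qed (use fired in \<open>auto intro: simulates.intros\<close>)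
next
  case finished
  then show ?thesis using no_sc_step_G' assms(2) by (auto simp: derivable_def)
qed

lemma simulates_reachable: "(sc_step G')\<^sup>*\<^sup>* [NT (start G')] w \<Longrightarrow> simulates w"
proof (induction rule: rtranclp_induct)
  case base
  then show ?case
    using simulates.idle[OF derivable_start] by (simp add: ctl_def)
next
  case (step y z)
  then show ?case by (blast intro: simulates_step)
qed

section \<open>Completeness: steps of \<open>G\<close> carried out in \<open>G'\<close>\<close>

lemma sc_step_G'I:
  "(B, y, P, F) \<in> rules \<Longrightarrow> P \<subseteq> set (u @ NT B # z) \<Longrightarrow> set (u @ NT B # z) \<inter> F = {} \<Longrightarrow>
    sc_step G' (u @ NT B # z) (u @ y @ z)"
  unfolding sc_step_def G'_simps by fastforce

text \<open>A rewriting of the leftmost symbol takes one \<open>direct\<close> step. Any other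
  rewriting keeps the leftmost symbol and takes \<open>choose\<close>, \<open>mark\<close>,
  \<open>check\<close>, \<open>fire\<close>, \<open>return\<close> in this order.\<close>

lemma sc'_step_simulated:
  assumes "sc'_step G (X # v) w'" "set (X # v) \<subseteq> voc G"
  shows "\<exists>Y v'. w' = Y # v' \<and> (sc_step G')\<^sup>*\<^sup>* (ctl (Idle X) # v) (ctl (Idle Y) # v')"
proof -
  from assms(1) obtain A x Per For u z where p: "(A, x, Per, For) \<in> prods G"
    and w: "X # v = u @ NT A # z" "w' = u @ x @ z"
    and Per: "Per \<subseteq> set (u @ z)" and For: "set (u @ z) \<inter> For = {}"
    unfolding sc'_step_def by auto
  note pD = prodD[OF p]
  have X: "X \<in> voc G" using assms(2) by simp
  show ?thesis
  proof (cases u)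
    case Nil
    obtain Y y where x: "x = Y # y" using pD(3) by (cases x) auto
    \<comment> \<open>The \<open>SC\<close> test sees the whole form, but its head is now a control,
      so it amounts to a test of the context \<open>z\<close>.\<close>
    have "ctl (Idle (NT A)) \<notin> For" using pD by auto
    then have "sc_step G' (ctl (Idle X) # v) (ctl (Idle Y) # y @ v)"
      using sc_step_G'I[OF rules.direct[OF p], of "[]" z] Nil w Per For x by (auto simp: ctl_def)
    then show ?thesis using w x Nil by auto
  next
    case (Cons X' v1)
    then have v: "v = v1 @ NT A # z" and w': "w' = X # v1 @ x @ z" using w by auto
    have X': "X' = X" using Cons w by simp
    let ?r = "(A, x, Per, For)"
    have "NT A \<noteq> ctl Mark" using pD(2) ctl_notin_voc by metis
    then have Mark: "ctl Mark \<notin> set v1 \<union> set z \<union> {NT A}" "ctl Mark \<notin> set x" "ctl Mark \<notin> Per \<union> For"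
      using assms(2) v pD ctl_notin_voc[of Mark] by auto
    have ne: "ctl (Guess X ?r) \<noteq> ctl Mark" "ctl (Fire X ?r) \<noteq> ctl Mark" using X p by auto
    have "ctl (Guess X ?r) \<notin> For" using pD by auto
    have "sc_step G' (ctl (Idle X) # v) (ctl (Guess X ?r) # v)"
      using sc_step_G'I[OF rules.choose[OF p X], of "[]" v] by (simp add: ctl_def)
    moreover have "sc_step G' (ctl (Guess X ?r) # v) (ctl (Guess X ?r) # v1 @ ctl Mark # z)"
      using sc_step_G'I[OF rules.mark[OF p X], of "ctl (Guess X ?r) # v1" z] Mark ne v by auto
    \<comment> \<open>With \<open>NT A\<close> hidden by the marker, the test of the whole form sees
      exactly the symbols of \<open>v1\<close> and \<open>z\<close> from \<open>voc G\<close>;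
      \<open>X\<close>, the rest of the context, is handled by the shape of the rule.\<close>
    moreover have "sc_step G' (ctl (Guess X ?r) # v1 @ ctl Mark # z) (ctl (Fire X ?r) # v1 @ ctl Mark # z)"
      using sc_step_G'I[OF rules.check[OF p X], of "[]" "v1 @ ctl Mark # z"] Mark
        \<open>ctl (Guess X ?r) \<notin> For\<close> Per For Cons X' by (auto simp: ctl_def)
    moreover have "sc_step G' (ctl (Fire X ?r) # v1 @ ctl Mark # z) (ctl (Fire X ?r) # v1 @ x @ z)"
      using sc_step_G'I[OF rules.fire[OF p X], of "ctl (Fire X ?r) # v1" z] by (simp add: ctl_def)
    moreover have "sc_step G' (ctl (Fire X ?r) # v1 @ x @ z) (ctl (Idle X) # v1 @ x @ z)"
      using sc_step_G'I[OF rules.return[OF p X], of "[]" "v1 @ x @ z"] Mark ne by (auto simp: ctl_def)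
    ultimately have "(sc_step G')\<^sup>*\<^sup>* (ctl (Idle X) # v) (ctl (Idle X) # v1 @ x @ z)"
      by (meson converse_rtranclp_into_rtranclp rtranclp.rtrancl_refl)
    then show ?thesis using w' by auto
  qed
qed

text \<open>\<open>derivable w\<close> is carried through the induction to supply the alphabet
  condition of \<open>sc'_step_simulated\<close>.\<close>

lemma derivable_simulated:
  assumes "(sc'_step G)\<^sup>*\<^sup>* [NT (start G)] w"
  shows "derivable w \<and>
    (\<exists>X v. w = X # v \<and> (sc_step G')\<^sup>*\<^sup>* [NT (start G')] (ctl (Idle X) # v))"
  using assms
proof (induction rule: rtranclp_induct)
  case base
  then show ?case using derivable_start by (auto simp: ctl_def)
next
  case (step y z)
  then obtain X v where y: "y = X # v" "(sc_step G')\<^sup>*\<^sup>* [NT (start G')] (ctl (Idle X) # v)"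
    by blast
  from step.hyps(2) obtain A x Per For u v' where "(A, x, Per, For) \<in> prods G"
    "y = u @ NT A # v'" "z = u @ x @ v'" "Per \<subseteq> set (u @ v')" "set (u @ v') \<inter> For = {}"
    unfolding sc'_step_def by auto
  then have "derivable z"
    using step.IH derivable_step by blast
  moreover have "set (X # v) \<subseteq> voc G" using step.IH y by (auto simp: derivable_def)
  ultimately show ?case
    using sc'_step_simulated step.hyps(2) y by (metis rtranclp_trans)
qed

lemma lang_sc_G': "lang_sc G' = lang_sc' G"
proof (intro set_eqI iffI)
  fix w
  assume "w \<in> lang_sc G'"
  then have w: "set w \<subseteq> tms G" "simulates (map Tm w)"
    using simulates_reachable by (auto simp: lang_sc_def)
  from w(2) have "derivable (map Tm w)"
    \<comment> \<open>Only \<open>finished\<close> is possible: all other represented forms start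
      with a control, which is not a terminal.\<close>
    by cases auto
  then show "w \<in> lang_sc' G"
    using w by (simp add: lang_sc'_def derivable_def)
next
  fix w
  assume "w \<in> lang_sc' G"
  then have w: "set w \<subseteq> tms G" "(sc'_step G)\<^sup>*\<^sup>* [NT (start G)] (map Tm w)"
    by (auto simp: lang_sc'_def)
  \<comment> \<open>Without erasing productions the word has a leftmost letter; its control is
    released by \<open>finish\<close> as the very last step.\<close>
  then obtain a u where u: "w = a # u"
    and "(sc_step G')\<^sup>*\<^sup>* [NT (start G')] (ctl (Idle (Tm a)) # map Tm u)"
    using derivable_simulated[OF w(2)] by auto
  moreover have "sc_step G' (ctl (Idle (Tm a)) # map Tm u) (map Tm w)"
    using sc_step_G'I[OF rules.finish[of a], of "[]" "map Tm u"] w u by (simp add: ctl_def)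
  ultimately show "w \<in> lang_sc G'"
    using w by (auto simp: lang_sc_def)
qed

end

section \<open>Choice of fresh codes and equality of the two families\<close>

lemma exists_fresh_code:
  assumes "finite C" "finite (M :: nat set)"
  shows "\<exists>f :: 'a \<Rightarrow> nat. inj_on f C \<and> (\<forall>c. f c \<notin> M)"
proof -
  obtain g :: "'a \<Rightarrow> nat" where g: "inj_on g C"
    using finite_imp_inj_to_nat_seg[OF assms(1)] by blast
  obtain k where k: "\<forall>n \<in> M. n \<le> k"
    using assms(2) finite_nat_set_iff_bounded_le by blast
  have "inj_on (\<lambda>c. Suc k + g c) C" using g by (simp add: inj_on_def)
  \<comment> \<open>The shift beyond the bound \<open>k\<close> avoids \<open>M\<close> at every
    argument, also outside \<open>C\<close>, as the locale demands.\<close>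
  moreover have "Suc k + g c \<notin> M" for c using k by force
  ultimately show ?thesis by blast
qed

lemma SC'11_subset_SC11: "(SC'11 :: 't list set set) \<subseteq> SC11"
proof
  fix L :: "'t list set"
  assume "L \<in> SC'11"
  then obtain G where G_gram: "sc11_grammar G" and L: "L = lang_sc' G"
    unfolding SC'11_def by blast
  from G_gram have fin: "finite (prods G)" "finite (voc G)" "finite (nts G)"
    by (auto simp: sc11_grammar_def voc_def)
  then have "finite (controls G)" by (simp add: controls_def)
  from exists_fresh_code[OF this fin(3)]
  obtain code where "inj_on code (controls G)" "\<forall>c. code c \<notin> nts G"
    by (elim exE conjE)
  then interpret simulation G code
    using G_gram by unfold_locales simp_all
  show "L \<in> SC11"
    unfolding SC11_def using sc11_grammar_G' lang_sc_G' L by blast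
qed

theorem theorem2:
  shows "(SC11 :: 't list set set) = SC'11"
  using SC11_subset_SC'11 SC'11_subset_SC11 by blast

end
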